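(* Let $P=\sigma_1$-$\sigma_2$-$\sigma_3$-$\sigma_4$ and $Q=\sigma_1$-$\sigma_2\sigma_3$-$\sigma_4$ be two nontrivial partially ordered generalized patterns, where $\sigma_2$ and $\sigma_3$ are (nonempty and) contiguous, and assume that the rightmost letter of $\sigma_2$ is less than or equal to the leftmost letter of $\sigma_3$. Then $\mathrm{Av}(P)=\mathrm{Av}(Q)$ if and only if $P$ has at least one of the following properties: (1) $\sigma_2=1\dots1$, $\sigma_3=2$, and $P'\in\{1,2\}^*$. (2) $\sigma_2=1$, $\sigma_3=2\dots2$, and $P'\in\{1,2\}^*$. (3) $\sigma_2=2\dots21$, $\sigma_3=2\dots2$, $P'\in\{1,2\}^*$ and the letter $1$ appears exactly once in $P$. (4) $\sigma_2=1\dots1$, $\sigma_3=21\dots1$, $P'\in\{1,2\}^*$ and the letter $2$ appears exactly once in $P$. (5) $\sigma_2=1\dots1$, $\sigma_3=3$, $P'\in\{1,2,3\}^*$ and the letter $2$ appears exactly once in $P$. (6) $\sigma_2=1$, $\sigma_3=3\dots3$, $P'\in\{1,2,3\}^*$ and the letter $2$ appears exactly once in $P$.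
   Context: A permutation of length $n$ is a word containing each element of $\{1,\dots,n\}$ exactly once; $\mathcal{S}$ is the set of all permutations of all lengths $n\ge0$. A partially ordered generalized pattern $P$ is a nonempty word $p_1p_2\dots p_m$ of positive integers (repetitions allowed), whose set of letters is $\{1,2,\dots,r\}$ for some $r$, with a dash written between some of the consecutive letters. $P'$ denotes the word $p_1\dots p_m$ obtained from $P$ by removing all dashes. An occurrence of $P$ in a permutation $\pi=a_1\dots a_n$ is a subsequence $a_{k_1}\dots a_{k_m}$, $k_1<\dots<k_m$, such that (a) $p_i>p_j$ implies $a_{k_i}>a_{k_j}$ for all $i,j$ (no condition when $p_i=p_j$), and (b) $k_{i+1}=k_i+1$ whenever $p_i$ and $p_{i+1}$ are not separated by a dash. $\mathrm{Av}(P)$ is the set of permutations in $\mathcal{S}$ with no occurrence of $P$. A pattern is nontrivial if it does not consist only of the letter $1$. A pattern segment is contiguous if it contains no dash. Here $\sigma_1,\dots,\sigma_4$ are the segments making up $P$; $\sigma_1$ and $\sigma_4$ may themselves contain dashes and may be empty (in which case the adjoining dash is omitted); $Q$ is $P$ with the dash between $\sigma_2$ and $\sigma_3$ removed. $1\dots1$ denotes a string of one or more $1$'s, and similarly for $2\dots2$, $3\dots3$ (so $2\dots21$ is one or more $2$'s followed by a $1$, and $21\dots1$ is a $2$ followed by one or more $1$'s). For a set $A$ of letters, $A^*$ denotes the set of all strings over $A$. *)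

theory Defs
  imports Main "HOL-Combinatorics.Multiset_Permutations"
begin

definition perms :: "nat list set" where
  "perms = (\<Union>n. permutations_of_set {1..n})"

text \<open>
  A dashed word is represented by the list of its maximal dash-free blocks: for instance
  1-32-2 is \<open>[[1], [3, 2], [2]]\<close>. All blocks are nonempty, so this is a one-to-one encoding.
  A possibly empty segment that may itself contain dashes is again a list of blocks, and
  joining segments by dashes is list append; an empty segment then contributes no dash.
  The underlying word without dashes is \<open>concat P\<close>.
\<close>

type_synonym dashed_word = "nat list list"

definition po_pattern :: "dashed_word \<Rightarrow> bool" where
  "po_pattern P \<longleftrightarrow> P \<noteq> [] \<and> [] \<notin> set P \<and> (\<exists>r. set (concat P) = {1..r})"

definition nontrivial :: "dashed_word \<Rightarrow> bool" where
  "nontrivial P \<longleftrightarrow> \<not> set (concat P) \<subseteq> {1}"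

text \<open>There is a dash between the letters at (0-based) positions \<open>i\<close> and \<open>Suc i\<close> iff
  some proper initial part of the list of blocks has exactly \<open>Suc i\<close> letters.\<close>

definition dash_after :: "dashed_word \<Rightarrow> nat \<Rightarrow> bool" where
  "dash_after P i \<longleftrightarrow> (\<exists>j<length P. length (concat (take j P)) = Suc i)"

text \<open>An occurrence is given by the list \<open>ks\<close> of its (0-based) positions in \<open>\<pi>\<close>.\<close>

definition occurrence :: "dashed_word \<Rightarrow> nat list \<Rightarrow> nat list \<Rightarrow> bool" where
  "occurrence P \<pi> ks \<longleftrightarrow>
     (let p = concat P; m = length p in
        length ks = m \<and> sorted_wrt (<) ks \<and> (\<forall>k\<in>set ks. k < length \<pi>) \<and>
        (\<forall>i<m. \<forall>j<m. p ! i > p ! j \<longrightarrow> \<pi> ! (ks ! i) > \<pi> ! (ks ! j)) \<and>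
        (\<forall>i. Suc i < m \<longrightarrow> \<not> dash_after P i \<longrightarrow> ks ! Suc i = Suc (ks ! i)))"

definition Av :: "dashed_word \<Rightarrow> nat list set" where
  "Av P = {\<pi> \<in> perms. \<not> (\<exists>ks. occurrence P \<pi> ks)}"

end

theory Submission imports Defs begin

text \<open>
  An occurrence of \<open>Q\<close> is one of \<open>P\<close>, so the question is whether every permutation containing \<open>P\<close>
  contains \<open>Q\<close>. In each of the six cases an occurrence of \<open>P\<close> is repaired by sliding the two
  blocks together between their old positions: they meet where the values first or last cross a
  threshold separating small from large letters (cases 1, 2, 5, 6), or at the minimum (case 3) or
  the maximum (case 4) of the values in between.

  In all other cases, take a permutation whose length is that of \<open>P\<close> and which realizes \<open>P\<close>, and
  insert one or two values between the two blocks. An occurrence of \<open>Q\<close> omits one or two values, so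
  it is almost rigid, and suitable inserted values (a new maximum, a new minimum, a maximum followed
  by a minimum, or a value in the middle) leave too few values above or below some letter.
\<close>

section \<open>Occurrences as functions from letters to positions\<close>

text \<open>A function replaces the list of positions so that an occurrence can be moved pointwise;
  only its values on \<open>{..<m}\<close> matter.\<close>

definition occ_at :: "dashed_word \<Rightarrow> nat list \<Rightarrow> (nat \<Rightarrow> nat) \<Rightarrow> bool" where
  "occ_at R \<pi> k \<longleftrightarrow>
     (let p = concat R; m = length p in
        strict_mono_on {..<m} k \<and> k ` {..<m} \<subseteq> {..<length \<pi>} \<and>
        (\<forall>i<m. \<forall>j<m. p ! j < p ! i \<longrightarrow> \<pi> ! k j < \<pi> ! k i) \<and>
        (\<forall>i. Suc i < m \<longrightarrow> \<not> dash_after R i \<longrightarrow> k (Suc i) = Suc (k i)))"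

lemma ex_occurrence_iff: "(\<exists>ks. occurrence R \<pi> ks) \<longleftrightarrow> (\<exists>k. occ_at R \<pi> k)"
proof
  assume "\<exists>ks. occurrence R \<pi> ks"
  then obtain ks where "occurrence R \<pi> ks" ..
  then have "occ_at R \<pi> ((!) ks)"
    unfolding occurrence_def occ_at_def Let_def
    by (auto simp: strict_mono_on_def sorted_wrt_iff_nth_less)
  then show "\<exists>k. occ_at R \<pi> k" by blast
next
  assume "\<exists>k. occ_at R \<pi> k"
  then obtain k where "occ_at R \<pi> k" ..
  then have "occurrence R \<pi> (map k [0..<length (concat R)])"
    unfolding occurrence_def occ_at_def Let_def
    by (auto simp: strict_mono_on_def sorted_wrt_iff_nth_less image_subset_iff)
  then show "\<exists>ks. occurrence R \<pi> ks" by blast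
qed

lemma Av_iff: "\<pi> \<in> Av R \<longleftrightarrow> \<pi> \<in> perms \<and> (\<nexists>k. occ_at R \<pi> k)"
  by (auto simp: Av_def simp flip: ex_occurrence_iff)

lemma perms_distinct: "\<pi> \<in> perms \<Longrightarrow> distinct \<pi>"
  by (auto simp: perms_def permutations_of_set_def)

text \<open>Each entry is replaced by its rank among all entries. Occurrences depend only on the
  relative order, so a counterexample may be any word with distinct entries.\<close>

lemma standardization:
  fixes xs :: "nat list"
  assumes "distinct xs"
  obtains \<pi> where "\<pi> \<in> perms" "length \<pi> = length xs"
    "\<And>i j. i < length xs \<Longrightarrow> j < length xs \<Longrightarrow> \<pi> ! i < \<pi> ! j \<longleftrightarrow> xs ! i < xs ! j"
proof -
  define rk where "rk x = card {z \<in> set xs. z \<le> x}" for x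
  have less: "rk x < rk y" if "x < y" "y \<in> set xs" for x y
    proof -
    have "y \<in> {z \<in> set xs. z \<le> y}" "y \<notin> {z \<in> set xs. z \<le> x}" using that by auto
    then have "{z \<in> set xs. z \<le> x} \<subset> {z \<in> set xs. z \<le> y}" using that by fastforce
    then show ?thesis unfolding rk_def by (intro psubset_card_mono) auto
  qed
  have less_iff: "rk x < rk y \<longleftrightarrow> x < y" if "x \<in> set xs" "y \<in> set xs" for x y
    using less[of x y] less[of y x] that by (cases x y rule: linorder_cases) auto
  have inj: "inj_on rk (set xs)"
    by (rule inj_onI) (metis less_iff less_irrefl linorder_neqE_nat)
  have "rk x \<in> {1..length xs}" if "x \<in> set xs" for x
  proof -
    have "rk x \<le> card (set xs)" unfolding rk_def by (rule card_mono) auto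
    moreover have "rk x > 0" unfolding rk_def using that by (auto simp: card_gt_0_iff)
    ultimately show ?thesis using distinct_card[OF assms] by auto
  qed
  then have "rk ` set xs = {1..length xs}"
    by (intro card_subset_eq) (auto simp: card_image[OF inj] distinct_card[OF assms])
  then have "map rk xs \<in> perms"
    using assms inj by (auto simp: perms_def permutations_of_set_def distinct_map)
  then show thesis
    by (rule that) (auto simp: less_iff)
qed

lemma occ_at_cong:
  assumes "length \<pi> = length xs"
    and "\<And>i j. i < length xs \<Longrightarrow> j < length xs \<Longrightarrow> \<pi> ! i < \<pi> ! j \<longleftrightarrow> xs ! i < xs ! j"
  shows "occ_at R \<pi> k \<longleftrightarrow> occ_at R xs k"
  using assms unfolding occ_at_def Let_def by (auto simp: image_subset_iff)

lemma occ_at_contiguous: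
  assumes "occ_at R \<pi> k"
    and "\<And>i. a \<le> i \<Longrightarrow> Suc i < b \<Longrightarrow> \<not> dash_after R i"
    and "b \<le> length (concat R)" "a \<le> i" "i \<le> j" "j < b"
  shows "k j = k i + (j - i)"
  using \<open>i \<le> j\<close> \<open>j < b\<close>
proof (induction j rule: dec_induct)
  case (step n)
  have "k (Suc n) = Suc (k n)"
    using assms(1) assms(2)[of n] assms(3,4) step unfolding occ_at_def Let_def by auto
  with step show ?case by auto
qed auto

text \<open>The starting indices of the blocks. They behave additively under append, which makes the
  dashes of \<open>P\<close> and \<open>Q\<close> computable.\<close>

definition offsets :: "dashed_word \<Rightarrow> nat set" where
  "offsets R = (\<lambda>j. length (concat (take j R))) ` {..<length R}"

lemma dash_after_iff: "dash_after R i \<longleftrightarrow> Suc i \<in> offsets R"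
  by (force simp: dash_after_def offsets_def)

lemma offsets_append: "offsets (A @ B) = offsets A \<union> (+) (length (concat A)) ` offsets B"
proof -
  have "{..<length (A @ B)} = {..<length A} \<union> (+) (length A) ` {..<length B}"
    by (simp add: lessThan_atLeast0 image_add_atLeastLessThan ivl_disj_un_two add.commute)
  then show ?thesis
    by (simp add: offsets_def image_Un image_image)
qed

lemma offsets_Cons: "offsets (x # B) = insert 0 ((+) (length x) ` offsets B)"
  using offsets_append[of "[x]" B] by (simp add: offsets_def lessThan_Suc)

lemma offsets_le: "x \<in> offsets R \<Longrightarrow> x \<le> length (concat R)"
proof -
  assume "x \<in> offsets R"
  then obtain j where "x = length (concat (take j R))" by (auto simp: offsets_def)
  also have "\<dots> \<le> length (concat (take j R) @ concat (drop j R))" by simp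
  also have "concat (take j R) @ concat (drop j R) = concat R" by (simp flip: concat_append)
  finally show "x \<le> length (concat R)" .
qed

section \<open>The two patterns on their common underlying word\<close>

locale fused_blocks =
  fixes \<sigma>1 \<sigma>4 :: dashed_word and \<sigma>2 \<sigma>3 :: "nat list"
  assumes \<sigma>2_ne: "\<sigma>2 \<noteq> []" and \<sigma>3_ne: "\<sigma>3 \<noteq> []"
begin

text \<open>In the common underlying word \<open>p\<close>, \<open>\<sigma>2\<close> occupies the positions \<open>e..<d\<close> and \<open>\<sigma>3\<close> the
  positions \<open>d..<f\<close>.\<close>

definition P :: dashed_word where "P = \<sigma>1 @ [\<sigma>2] @ [\<sigma>3] @ \<sigma>4"
definition Q :: dashed_word where "Q = \<sigma>1 @ [\<sigma>2 @ \<sigma>3] @ \<sigma>4"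
definition p :: "nat list" where "p = concat P"
definition m :: nat where "m = length p"
definition e :: nat where "e = length (concat \<sigma>1)"
definition d :: nat where "d = e + length \<sigma>2"
definition f :: nat where "f = d + length \<sigma>3"

lemma concat_P: "concat P = p" and concat_Q: "concat Q = p"
  by (simp_all add: p_def P_def Q_def)

lemma bounds: "e < d" "d < f" "f \<le> m" "d - 1 < m" "f - 1 < m"
proof -
  show *: "e < d" "d < f" "f \<le> m"
    using \<sigma>2_ne \<sigma>3_ne by (auto simp: e_def d_def f_def m_def p_def P_def)
  from * show "d - 1 < m" "f - 1 < m" by linarith+
qed

lemma nth_\<sigma>2: "i < length \<sigma>2 \<Longrightarrow> p ! (e + i) = \<sigma>2 ! i"
  by (simp add: p_def P_def e_def nth_append)

lemma nth_\<sigma>3: "i < length \<sigma>3 \<Longrightarrow> p ! (d + i) = \<sigma>3 ! i"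
  by (simp add: p_def P_def e_def d_def nth_append)

lemma offsets_P: "offsets P = offsets \<sigma>1 \<union> {e, d} \<union> (+) f ` offsets \<sigma>4"
  by (auto simp: P_def offsets_append offsets_Cons e_def d_def f_def image_image add.assoc
      image_Un offsets_def[of "[]"])

lemma offsets_Q: "offsets Q = offsets \<sigma>1 \<union> {e} \<union> (+) f ` offsets \<sigma>4"
  by (auto simp: Q_def offsets_append offsets_Cons e_def d_def f_def image_image add.assoc)

lemma dash_P: "dash_after P i \<longleftrightarrow> dash_after Q i \<or> Suc i = d"
  by (auto simp: dash_after_iff offsets_P offsets_Q)

text \<open>No block of \<open>\<sigma>1\<close> starts after \<open>e\<close>, and
  \<open>\<sigma>4\<close> starts at \<open>f\<close> at the earliest.\<close>

lemma no_dash_Q: "e \<le> i \<Longrightarrow> Suc i < f \<Longrightarrow> \<not> dash_after Q i"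
  using offsets_le[of "Suc i" \<sigma>1] by (auto simp: dash_after_iff offsets_Q e_def)

lemma occ_Q_imp_P: "occ_at Q \<pi> k \<Longrightarrow> occ_at P \<pi> k"
  unfolding occ_at_def Let_def concat_P concat_Q dash_P by auto

lemma Av_eq_iff: "Av P = Av Q \<longleftrightarrow> (\<forall>\<pi>\<in>perms. \<forall>k. occ_at P \<pi> k \<longrightarrow> (\<exists>k. occ_at Q \<pi> k))"
  using occ_Q_imp_P by (auto simp: set_eq_iff Av_iff)

lemmas occ_at_PQ = occ_at_def[of P] occ_at_def[of Q]

section \<open>Repairing an occurrence of the dashed pattern by sliding\<close>

context
  fixes \<pi> k
  assumes occ: "occ_at P \<pi> k"
begin

lemma k_less: "i < j \<Longrightarrow> j < m \<Longrightarrow> k i < k j"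
  using occ by (auto simp: occ_at_PQ Let_def concat_P m_def strict_mono_on_def)

lemma k_bound: "i < m \<Longrightarrow> k i < length \<pi>"
  using occ by (auto simp: occ_at_PQ Let_def concat_P m_def)

lemma k_order: "i < m \<Longrightarrow> j < m \<Longrightarrow> p ! j < p ! i \<Longrightarrow> \<pi> ! k j < \<pi> ! k i"
  using occ by (auto simp: occ_at_PQ Let_def concat_P m_def)

text \<open>Positions are counted back from the last letter of \<open>\<sigma>2\<close>, where the
  blocks are to meet; the additive form avoids subtracting from \<open>k (d - 1)\<close>.\<close>

lemma k_\<sigma>2: "e \<le> i \<Longrightarrow> i < d \<Longrightarrow> k i + (d - 1 - i) = k (d - 1)"
  by (subst (2) occ_at_contiguous[OF occ, where a = e and b = d and i = i])
     (use bounds no_dash_Q in \<open>auto simp: dash_P concat_P simp flip: m_def\<close>)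

lemma k_\<sigma>3: "d \<le> i \<Longrightarrow> i < f \<Longrightarrow> k i = k d + (i - d)"
  by (rule occ_at_contiguous[OF occ, where a = d and b = f])
     (use bounds no_dash_Q in \<open>auto simp: dash_P concat_P simp flip: m_def\<close>)

lemma k_\<sigma>2_cases:
  assumes "k e \<le> x" "x \<le> k (d - 1)"
  obtains i where "e \<le> i" "i < d" "x = k i"
proof -
  define i where "i = d - 1 - (k (d - 1) - x)"
  have "k (d - 1) - x \<le> d - 1 - e" using assms k_\<sigma>2[of e] bounds by linarith
  then have i: "e \<le> i" "i < d" "i + (k (d - 1) - x) = d - 1"
    unfolding i_def using bounds by linarith+
  moreover have "x = k i" using k_\<sigma>2[OF i(1,2)] i(3) assms(2) by linarith
  ultimately show thesis by (intro that[of i])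
qed

lemma k_\<sigma>3_cases:
  assumes "k d \<le> x" "x \<le> k (f - 1)"
  obtains i where "d \<le> i" "i < f" "x = k i"
proof -
  let ?i = "d + (x - k d)"
  have "?i < f" using assms k_\<sigma>3[of "f - 1"] bounds by auto
  moreover from this have "x = k ?i" using k_\<sigma>3[of ?i] assms(1) by simp
  ultimately show thesis using that[of ?i] by simp
qed

text \<open>Slides the two blocks towards each other until \<open>\<sigma>3\<close> starts at position \<open>q\<close>.\<close>

definition slide :: "nat \<Rightarrow> nat \<Rightarrow> nat" where
  "slide q i = (if e \<le> i \<and> i < f then q + i - d else k i)"

text \<open>The fused block stays within the old span of the two blocks, hence clear of the
  positions of all other letters.\<close>

lemma slide_range:
  assumes "k (d - 1) < q" "q \<le> k d" "e \<le> i" "i < f"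
  shows "k e \<le> slide q i" "slide q i \<le> k (f - 1)"
  using assms k_\<sigma>2[of e] k_\<sigma>3[of "f - 1"] bounds by (auto simp: slide_def)

text \<open>Increasing positions and adjacency survive every slide, so only the order of the values
  is left as a premise.\<close>

lemma occ_at_Q_slide:
  assumes q: "k (d - 1) < q" "q \<le> k d"
    and ord: "\<And>i j. i < m \<Longrightarrow> j < m \<Longrightarrow> p ! j < p ! i \<Longrightarrow> \<pi> ! slide q j < \<pi> ! slide q i"
  shows "occ_at Q \<pi> (slide q)"
proof -
  have f_m: "f - 1 < m" using bounds by auto
  \<comment> \<open>This keeps \<open>q + i - d\<close> from being truncated when
    \<open>e \<le> i\<close>.\<close>
  have qd: "d \<le> q + e" using q k_\<sigma>2[of e] bounds by auto
  have "strict_mono_on {..<m} (slide q)"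
  proof (rule strict_mono_onI)
    fix i j assume "i \<in> {..<m}" "j \<in> {..<m}" "i < j"
    then have ij: "i < j" "j < m" by auto
    consider "e \<le> i" "j < f" | "j < e \<or> f \<le> i \<or> (i < e \<and> f \<le> j)" | "i < e" "e \<le> j" "j < f"
      | "e \<le> i" "i < f" "f \<le> j" by linarith
    then show "slide q i < slide q j"
    proof cases
      case 1 with ij qd show ?thesis by (auto simp: slide_def)
    next
      case 2 with ij bounds k_less[of i j] show ?thesis by (auto simp: slide_def)
    next
      case 3
      with k_less[of i e] slide_range[OF q, of j] bounds show ?thesis by (auto simp: slide_def)
    next
      case 4
      then have "k (f - 1) < k j" using ij bounds by (intro k_less) auto
      with 4 slide_range[OF q, of i] bounds show ?thesis by (auto simp: slide_def)
    qed
  qed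
  moreover have "slide q i < length \<pi>" if "i < m" for i
    using that slide_range(2)[OF q, of i] k_bound[of i] k_bound[of "f - 1", OF f_m] bounds
    by (cases "e \<le> i \<and> i < f") (auto simp: slide_def)
  moreover have "slide q (Suc i) = Suc (slide q i)" if "Suc i < m" "\<not> dash_after Q i" for i
  proof -
    have "e \<in> offsets Q" by (simp add: offsets_Q)
    then have "Suc i \<noteq> e" using that by (auto simp: dash_after_iff)
    \<comment> \<open>If a letter has index \<open>f\<close>, it starts \<open>\<sigma>4\<close>, so
      a dash precedes it and no adjacency is required there.\<close>
    moreover have "Suc i \<noteq> f"
    proof
      assume *: "Suc i = f"
      have "\<sigma>4 \<noteq> []"
        using that(1) * by (auto simp: m_def p_def P_def f_def d_def e_def)
      then have "0 \<in> offsets \<sigma>4" by (cases \<sigma>4) (auto simp: offsets_Cons)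
      then have "f \<in> offsets Q" by (force simp: offsets_Q)
      with that * show False by (auto simp: dash_after_iff)
    qed
    ultimately consider "e \<le> i" "Suc i < f" | "Suc i < e \<or> f \<le> i" by linarith
    then show ?thesis
    proof cases
      case 1 with qd show ?thesis by (auto simp: slide_def)
    next
      case 2
      then have "Suc i \<noteq> d" using bounds by auto
      with that occ have "k (Suc i) = Suc (k i)"
        by (auto simp: occ_at_PQ Let_def concat_P m_def dash_P)
      with 2 bounds show ?thesis by (auto simp: slide_def)
    qed
  qed
  ultimately show ?thesis
    using ord by (auto simp: occ_at_PQ Let_def concat_Q simp flip: m_def)
qed

text \<open>Serves \<open>r = 2\<close> and \<open>r = 3\<close>. The value \<open>w\<close>
  separates the letters \<open>r\<close> from all smaller ones, and the slide has to keep the two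
  blocks on their sides of \<open>w\<close>. The premise \<open>mid\<close> protects letters
  strictly between \<open>1\<close> and \<open>r\<close> outside the blocks.\<close>

lemma threshold_occ_Q:
  assumes \<sigma>2: "\<And>i. e \<le> i \<Longrightarrow> i < d \<Longrightarrow> p ! i = 1" and \<sigma>3: "\<And>i. d \<le> i \<Longrightarrow> i < f \<Longrightarrow> p ! i = r"
    and range: "\<And>i. i < m \<Longrightarrow> 1 \<le> p ! i \<and> p ! i \<le> r" and r: "1 < r"
    and len: "length \<sigma>2 = 1 \<or> length \<sigma>3 = 1"
    and low: "\<And>i. i < m \<Longrightarrow> p ! i < r \<Longrightarrow> \<pi> ! k i \<le> w"
    and high: "\<And>i. i < m \<Longrightarrow> p ! i = r \<Longrightarrow> w < \<pi> ! k i"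
    and mid: "\<And>i x. i < m \<Longrightarrow> 1 < p ! i \<Longrightarrow> p ! i < r \<Longrightarrow> i < e \<or> f \<le> i \<Longrightarrow> k e \<le> x \<Longrightarrow>
      x \<le> k (f - 1) \<Longrightarrow> \<pi> ! x \<le> w \<Longrightarrow> \<pi> ! x < \<pi> ! k i"
  shows "\<exists>k. occ_at Q \<pi> k"
proof -
  have low2: "\<pi> ! k i \<le> w" if "e \<le> i" "i < d" for i using low[of i] \<sigma>2[of i] r that bounds by auto
  have high3: "w < \<pi> ! k i" if "d \<le> i" "i < f" for i using high[of i] \<sigma>3[of i] that bounds by auto
  obtain q where q: "k (d - 1) < q" "q \<le> k d"
    and lo: "\<And>i. e \<le> i \<Longrightarrow> i < d \<Longrightarrow> \<pi> ! slide q i \<le> w"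
    and hi: "\<And>i. d \<le> i \<Longrightarrow> i < f \<Longrightarrow> w < \<pi> ! slide q i"
    using len
  proof (elim disjE)
    assume "length \<sigma>2 = 1"
    then have ed: "e = d - 1" by (simp add: d_def)
    \<comment> \<open>The one-letter \<open>\<sigma>2\<close> moves to the last position before
      \<open>k d\<close> whose value is at most \<open>w\<close>; from there to the end of
      \<open>\<sigma>3\<close> all values exceed \<open>w\<close>.\<close>
    define S where "S = {x. x < k d \<and> \<pi> ! x \<le> w}"
    have S: "finite S" "k (d - 1) \<in> S"
      using low2[of "d - 1"] k_less[of "d - 1" d] bounds by (auto simp: S_def)
    then have "Max S \<in> S" and ge: "k (d - 1) \<le> Max S" by (auto intro: Max_in)
    then have mx: "Max S < k d" "\<pi> ! Max S \<le> w" by (auto simp: S_def)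
    have gt: "w < \<pi> ! x" if "Max S < x" "x \<le> k (f - 1)" for x
    proof (cases "x < k d")
      case True
      then have "x \<notin> S" using Max_ge[OF S(1), of x] that(1) by linarith
      with True show ?thesis by (simp add: S_def)
    next
      case False
      with that obtain i where "d \<le> i" "i < f" "x = k i" using k_\<sigma>3_cases[of x] by auto
      with high3 show ?thesis by simp
    qed
    show thesis
    proof (rule that[of "Suc (Max S)"])
      fix i assume "d \<le> i" "i < f"
      then show "w < \<pi> ! slide (Suc (Max S)) i"
        using slide_range(2)[of "Suc (Max S)" i] ge mx bounds by (intro gt) (auto simp: slide_def)
    next
      fix i assume "e \<le> i" "i < d"
      then have "slide (Suc (Max S)) i = Max S"
        using ed bounds unfolding slide_def by simp
      with mx show "\<pi> ! slide (Suc (Max S)) i \<le> w" by simp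
    qed (use ge mx in auto)
  next
    assume "length \<sigma>3 = 1"
    then have df: "f = Suc d" by (simp add: f_def)
    \<comment> \<open>The one-letter \<open>\<sigma>3\<close> moves to the first position after
      \<open>k (d - 1)\<close> whose value exceeds \<open>w\<close>; from \<open>k e\<close> up to
      that position all values are at most \<open>w\<close>.\<close>
    define q where "q = (LEAST x. k (d - 1) < x \<and> w < \<pi> ! x)"
    have ex: "k (d - 1) < k d \<and> w < \<pi> ! k d"
      using high3[of d] k_less[of "d - 1" d] bounds by auto
    then have q: "k (d - 1) < q" "w < \<pi> ! q" "q \<le> k d"
      unfolding q_def using LeastI[of "\<lambda>x. k (d - 1) < x \<and> w < \<pi> ! x"]
      by (blast intro: Least_le)+
    have le: "\<pi> ! x \<le> w" if "k e \<le> x" "x < q" for x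
    proof (cases "x \<le> k (d - 1)")
      case True
      with that obtain i where "e \<le> i" "i < d" "x = k i" using k_\<sigma>2_cases[of x] by blast
      with low2 show ?thesis by simp
    next
      case False
      have "\<not> (k (d - 1) < x \<and> w < \<pi> ! x)"
        using that(2) unfolding q_def by (rule not_less_Least)
      with False show ?thesis by simp
    qed
    show thesis
    proof (rule that[of q])
      fix i assume "e \<le> i" "i < d"
      then show "\<pi> ! slide q i \<le> w"
        using slide_range(1)[of q i] q bounds by (intro le) (auto simp: slide_def)
    next
      fix i assume "d \<le> i" "i < f"
      then have "slide q i = q"
        using df bounds unfolding slide_def by simp
      with q show "w < \<pi> ! slide q i" by simp
    qed (use q in auto)
  qed
  have "occ_at Q \<pi> (slide q)"
  proof (rule occ_at_Q_slide[OF q])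
    fix i j assume ij: "i < m" "j < m" "p ! j < p ! i"
    consider (oo) "i < e \<or> f \<le> i" "j < e \<or> f \<le> j"
      | (oj) "i < e \<or> f \<le> i" "e \<le> j" "j < d"
      | (jo) "d \<le> i" "i < f" "j < e \<or> f \<le> j"
      | (jj) "d \<le> i" "i < f" "e \<le> j" "j < d"
      | "e \<le> i" "i < d" | "d \<le> j" "j < f"
      by linarith
    then show "\<pi> ! slide q j < \<pi> ! slide q i"
    proof cases
      case oo with k_order[OF ij] bounds show ?thesis by (auto simp: slide_def)
    next
      case oj
      then have s: "slide q i = k i" by (auto simp: slide_def)
      show ?thesis
      proof (cases "p ! i = r")
        case True with lo[of j] oj high[of i] ij s show ?thesis by auto
      next
        case False
        then show ?thesis
          unfolding s using ij range[of i] range[of j] oj slide_range[OF q, of j] lo[of j] bounds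
          by (intro mid) auto
      qed
    next
      case jo
      then have "slide q j = k j" by (auto simp: slide_def)
      with jo low[of j] hi[of i] ij range[of i] show ?thesis by auto
    next
      case jj with lo[of j] hi[of i] show ?thesis by auto
    next
      case 5 with ij \<sigma>2[of i] range[of j] show ?thesis by auto
    next
      case 6 with ij \<sigma>3[of j] range[of i] show ?thesis by auto
    qed
  qed
  then show ?thesis by blast
qed

text \<open>The least value from \<open>k (d - 1)\<close> up to but excluding \<open>k d\<close>
  lies below all other values in the span, because the positions outside this gap play letters
  \<open>2\<close>. It becomes the new \<open>1\<close>, and \<open>\<sigma>3\<close> starts right
  after it.\<close>

lemma unique_one_occ_Q:
  assumes "distinct \<pi>"
    and p: "\<And>i. i < m \<Longrightarrow> p ! i = (if i = d - 1 then 1 else 2)"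
  shows "\<exists>k. occ_at Q \<pi> k"
proof -
  have lt: "k (d - 1) < k d" using k_less bounds by auto
  obtain c where c: "k (d - 1) \<le> c" "c < k d"
    and min: "\<And>x. k (d - 1) \<le> x \<Longrightarrow> x < k d \<Longrightarrow> \<pi> ! c \<le> \<pi> ! x"
  proof -
    let ?I = "{k (d - 1)..<k d}"
    have "Min ((!) \<pi> ` ?I) \<in> (!) \<pi> ` ?I" using lt by (intro Min_in) auto
    then obtain c where "c \<in> ?I" "\<pi> ! c = Min ((!) \<pi> ` ?I)" by auto
    then show thesis by (intro that[of c]) auto
  qed
  have c_less: "\<pi> ! c < \<pi> ! x" if "k e \<le> x" "x \<le> k (f - 1)" "x \<noteq> c" for x
  proof -
    have *: "\<pi> ! c < \<pi> ! k i" if "i < m" "i \<noteq> d - 1" for i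
      using k_order[of i "d - 1"] p[of i] p[of "d - 1"] min[of "k (d - 1)"] that bounds lt by auto
    consider "x < k (d - 1)" | "k (d - 1) \<le> x" "x < k d" | "k d \<le> x" by linarith
    then show ?thesis
    proof cases
      case 1
      with that obtain i where "e \<le> i" "i < d" "x = k i" using k_\<sigma>2_cases[of x] by auto
      then show ?thesis using *[of i] 1 bounds by auto
    next
      case 2
      have "x < length \<pi>" "c < length \<pi>" using 2 c k_bound[of d] bounds by auto
      then have "\<pi> ! c \<noteq> \<pi> ! x" using assms(1) that by (simp add: nth_eq_iff_index_eq)
      with min[of x] 2 show ?thesis by auto
    next
      case 3
      with that obtain i where "d \<le> i" "i < f" "x = k i" using k_\<sigma>3_cases[of x] by auto
      then show ?thesis using *[of i] bounds by auto
    qed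
  qed
  have "occ_at Q \<pi> (slide (Suc c))"
  proof (rule occ_at_Q_slide)
    fix i j assume ij: "i < m" "j < m" "p ! j < p ! i"
    then have j: "j = d - 1" "i \<noteq> d - 1" using p[of i] p[of j] by (auto split: if_splits)
    then have sj: "slide (Suc c) j = c" using bounds by (auto simp: slide_def)
    show "\<pi> ! slide (Suc c) j < \<pi> ! slide (Suc c) i"
    proof (cases "e \<le> i \<and> i < f")
      case True
      have "slide (Suc c) i \<noteq> c" using True j c k_\<sigma>2[of i] k_\<sigma>2[of e] bounds by (auto simp: slide_def)
      with True slide_range[of "Suc c" i] c show ?thesis unfolding sj by (intro c_less) auto
    next
      case False
      then have "slide (Suc c) i = k i" by (auto simp: slide_def)
      then show ?thesis
        unfolding sj using k_order[OF ij] min[of "k j"] lt j by auto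
    qed
  qed (use c in auto)
  then show ?thesis by blast
qed

text \<open>Mirror image of \<open>unique_one_occ_Q\<close>: the gap now excludes
  \<open>k (d - 1)\<close> and includes \<open>k d\<close>, and \<open>\<sigma>3\<close> starts at
  its largest value.\<close>

lemma unique_two_occ_Q:
  assumes "distinct \<pi>"
    and p: "\<And>i. i < m \<Longrightarrow> p ! i = (if i = d then 2 else 1)"
  shows "\<exists>k. occ_at Q \<pi> k"
proof -
  have lt: "k (d - 1) < k d" using k_less bounds by auto
  obtain c where c: "k (d - 1) < c" "c \<le> k d"
    and max: "\<And>x. k (d - 1) < x \<Longrightarrow> x \<le> k d \<Longrightarrow> \<pi> ! x \<le> \<pi> ! c"
  proof -
    let ?I = "{k (d - 1)<..k d}"
    have "Max ((!) \<pi> ` ?I) \<in> (!) \<pi> ` ?I" using lt by (intro Max_in) auto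
    then obtain c where "c \<in> ?I" "\<pi> ! c = Max ((!) \<pi> ` ?I)" by auto
    then show thesis by (intro that[of c]) auto
  qed
  have c_greater: "\<pi> ! x < \<pi> ! c" if "k e \<le> x" "x \<le> k (f - 1)" "x \<noteq> c" for x
  proof -
    have *: "\<pi> ! k i < \<pi> ! c" if "i < m" "i \<noteq> d" for i
      using k_order[of d i] p[of i] p[of d] max[of "k d"] that bounds lt by auto
    consider "x \<le> k (d - 1)" | "k (d - 1) < x" "x \<le> k d" | "k d < x" by linarith
    then show ?thesis
    proof cases
      case 1
      with that obtain i where "e \<le> i" "i < d" "x = k i" using k_\<sigma>2_cases[of x] by auto
      then show ?thesis using *[of i] bounds by auto
    next
      case 2
      have "x < length \<pi>" "c < length \<pi>" using 2 c k_bound[of d] bounds by auto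
      then have "\<pi> ! c \<noteq> \<pi> ! x" using assms(1) that by (simp add: nth_eq_iff_index_eq)
      with max[of x] 2 show ?thesis by auto
    next
      case 3
      with that obtain i where "d \<le> i" "i < f" "x = k i" using k_\<sigma>3_cases[of x] by auto
      then show ?thesis using *[of i] bounds 3 by auto
    qed
  qed
  have "occ_at Q \<pi> (slide c)"
  proof (rule occ_at_Q_slide)
    fix i j assume ij: "i < m" "j < m" "p ! j < p ! i"
    then have j: "i = d" "j \<noteq> d" using p[of i] p[of j] by (auto split: if_splits)
    then have si: "slide c i = c" using bounds by (auto simp: slide_def)
    show "\<pi> ! slide c j < \<pi> ! slide c i"
    proof (cases "e \<le> j \<and> j < f")
      case True
      have "slide c j \<noteq> c" using True j c k_\<sigma>2[of e] bounds by (auto simp: slide_def)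
      with True slide_range[of c j] c show ?thesis unfolding si by (intro c_greater) auto
    next
      case False
      then have "slide c j = k j" by (auto simp: slide_def)
      then show ?thesis
        unfolding si using k_order[OF ij] max[of "k i"] lt j by auto
    qed
  qed (use c in auto)
  then show ?thesis by blast
qed

end

section \<open>Separating permutations obtained by insertion\<close>

text \<open>Such a \<open>w\<close> gives the letters of \<open>p\<close> distinct values realizing
  the pattern; equal letters may be ordered in any way.\<close>

definition compatible :: "(nat \<Rightarrow> nat) \<Rightarrow> bool" where
  "compatible w \<longleftrightarrow> inj_on w {..<m} \<and> (\<forall>i<m. \<forall>j<m. p ! j < p ! i \<longrightarrow> w j < w i)"

lemma compatible_less: "compatible w \<Longrightarrow> i < m \<Longrightarrow> j < m \<Longrightarrow> p ! j < p ! i \<Longrightarrow> w j < w i"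
  by (simp add: compatible_def)

lemma compatible_eqD: "compatible w \<Longrightarrow> w i = w j \<Longrightarrow> i < m \<Longrightarrow> j < m \<Longrightarrow> i = j"
  by (auto simp: compatible_def dest: inj_onD)

text \<open>Skipping \<open>ys\<close> yields an occurrence of \<open>P\<close>. An occurrence of
  \<open>Q\<close> reads off a compatible \<open>w\<close> and omits only \<open>length ys\<close>
  entries, so the fused block is read with a shift \<open>\<delta>\<close> of at most that size;
  \<open>no_Q\<close> excludes every such reading.\<close>

lemma insertion_separates:
  assumes v: "compatible v" and ys: "distinct ys" "set ys \<inter> v ` {..<m} = {}"
    and no_Q: "\<And>w \<delta>. compatible w \<Longrightarrow> w ` {..<m} \<subseteq> v ` {..<m} \<union> set ys \<Longrightarrow> \<delta> \<le> length ys \<Longrightarrow>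
      (\<And>i. e \<le> i \<Longrightarrow> i < f \<Longrightarrow> w i = (map v [0..<d] @ ys @ map v [d..<m]) ! (i + \<delta>)) \<Longrightarrow> False"
  shows "Av P \<noteq> Av Q"
proof -
  define xs where "xs = map v [0..<d] @ ys @ map v [d..<m]"
  have dm: "d \<le> m" using bounds by simp
  have len: "length xs = m + length ys" using dm by (simp add: xs_def)
  have ivl: "{..<m} = {0..<d} \<union> {d..<m}" using dm by auto
  have set_xs: "set xs = v ` {..<m} \<union> set ys" unfolding xs_def ivl by auto
  have "card (set xs) = m + length ys"
    unfolding set_xs using ys v
    by (subst card_Un_disjoint) (auto simp: card_image distinct_card compatible_def)
  then have dist: "distinct xs" by (simp add: card_distinct len)
  define k where "k i = (if i < d then i else i + length ys)" for i
  have xs_k: "xs ! k i = v i" if "i < m" for i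
    using that dm by (auto simp: xs_def k_def nth_append)
  have "occ_at P xs k"
    unfolding occ_at_PQ Let_def concat_P
    using compatible_less[OF v]
    by (auto simp: strict_mono_on_def xs_k len dash_P simp flip: m_def) (auto simp: k_def)
  moreover have "\<not> occ_at Q xs h" for h
  proof
    assume h: "occ_at Q xs h"
    note hP = occ_Q_imp_P[OF h]
    have h_less: "h i < m + length ys" if "i < m" for i using k_bound[OF hP that] len by simp
    have inj: "inj_on (\<lambda>i. xs ! h i) {..<m}"
    proof (rule inj_onI)
      fix i j assume "i \<in> {..<m}" "j \<in> {..<m}" "xs ! h i = xs ! h j"
      then have "h i = h j" using dist h_less len by (simp add: nth_eq_iff_index_eq)
      with k_less[OF hP, of i j] k_less[OF hP, of j i] \<open>i \<in> _\<close> \<open>j \<in> _\<close> show "i = j"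
        by (metis lessThan_iff less_irrefl linorder_neqE_nat)
    qed
    have ge: "i \<le> h i" if "i < m" for i
      using that
    proof (induction i)
      case (Suc i) then show ?case using k_less[OF hP, of i "Suc i"] by simp
    qed simp
    \<comment> \<open>Positions grow by at least one per letter. Applied from \<open>e\<close> to
      the last letter, this bounds the shift \<open>h e - e\<close> by
      \<open>length ys\<close>.\<close>
    have le: "h i + (j - i) \<le> h j" if "i \<le> j" "j < m" for i j
      using that
    proof (induction j rule: dec_induct)
      case (step n)
      with k_less[OF hP, of n "Suc n"] show ?case by simp
    qed simp
    have em: "e < m" using bounds by simp
    have contig: "h i = i + (h e - e)" if "e \<le> i" "i < f" for i
      using occ_at_contiguous[OF h, where a = e and b = f and i = e and j = i] no_dash_Q that bounds
        ge[OF em] by (auto simp: concat_Q simp flip: m_def)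
    have "h e + (m - 1 - e) \<le> h (m - 1)" using em by (intro le) auto
    moreover have "h (m - 1) < m + length ys" using em by (intro h_less) auto
    ultimately have \<delta>: "h e - e \<le> length ys" using em by linarith
    show False
    proof (rule no_Q[of "\<lambda>i. xs ! h i" "h e - e"])
      show "compatible (\<lambda>i. xs ! h i)"
        using inj k_order[OF hP] by (auto simp: compatible_def)
      show "(\<lambda>i. xs ! h i) ` {..<m} \<subseteq> v ` {..<m} \<union> set ys"
        unfolding set_xs[symmetric] using h_less len by auto
      show "xs ! h i = (map v [0..<d] @ ys @ map v [d..<m]) ! (i + (h e - e))"
        if "e \<le> i" "i < f" for i
        using contig[OF that] by (simp add: xs_def)
    qed (rule \<delta>)
  qed
  moreover obtain \<pi> where \<pi>: "\<pi> \<in> perms" "length \<pi> = length xs"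
    "\<And>i j. i < length xs \<Longrightarrow> j < length xs \<Longrightarrow> \<pi> ! i < \<pi> ! j \<longleftrightarrow> xs ! i < xs ! j"
    by (rule standardization[OF dist]) (erule that, simp_all)
  moreover have "occ_at R \<pi> h \<longleftrightarrow> occ_at R xs h" for R h
    by (rule occ_at_cong[OF \<pi>(2,3)])
  ultimately show ?thesis
    using \<pi>(1) unfolding Av_eq_iff by blast
qed

text \<open>After inserting a single value \<open>x\<close> between the two blocks, \<open>\<sigma>2\<sigma>3\<close> can only reappear
  shifted by one, so that \<open>x\<close> plays the last letter of \<open>\<sigma>2\<close>, or unshifted, so that \<open>x\<close> plays the
  first letter of \<open>\<sigma>3\<close>.\<close>

lemma single_insertion_separates:
  assumes v: "compatible v" and x: "x \<notin> v ` {..<m}"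
    and left: "\<And>w. compatible w \<Longrightarrow> (\<And>i. i < m \<Longrightarrow> w i \<in> insert x (v ` {..<m})) \<Longrightarrow>
      w (d - 1) = x \<Longrightarrow> (\<And>i. e \<le> i \<Longrightarrow> Suc i < d \<Longrightarrow> w i = v (Suc i)) \<Longrightarrow> False"
    and right: "\<And>w. compatible w \<Longrightarrow> (\<And>i. i < m \<Longrightarrow> w i \<in> insert x (v ` {..<m})) \<Longrightarrow>
      w d = x \<Longrightarrow> (\<And>i. d \<le> i \<Longrightarrow> Suc i < f \<Longrightarrow> w (Suc i) = v i) \<Longrightarrow> False"
  shows "Av P \<noteq> Av Q"
proof (rule insertion_separates[of v "[x]", OF v])
  fix w \<delta>
  assume w: "compatible w" "w ` {..<m} \<subseteq> v ` {..<m} \<union> set [x]"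
    and \<delta>: "\<delta> \<le> length [x]"
    and pos: "\<And>i. e \<le> i \<Longrightarrow> i < f \<Longrightarrow> w i = (map v [0..<d] @ [x] @ map v [d..<m]) ! (i + \<delta>)"
  have w': "w i \<in> insert x (v ` {..<m})" if "i < m" for i using w(2) that by auto
  consider "\<delta> = 0" | "\<delta> = 1" using \<delta> by fastforce
  then show False
  proof cases
    case 1
    show False
      by (rule right[OF w(1) w'])
        (use pos 1 bounds in \<open>auto simp: nth_append Suc_diff_le\<close>)
  next
    case 2
    show False
      by (rule left[OF w(1) w'])
        (use pos 2 bounds in \<open>auto simp: nth_append\<close>)
  qed
qed (use x in auto)

text \<open>Here \<open>t\<close> decides between equal letters, and the parity of the values leaves room next to
  each of them.\<close>

lemma compatible_exists:
  fixes t :: "nat \<Rightarrow> nat"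
  assumes "inj_on t {..<m}" "\<And>i. i < m \<Longrightarrow> t i \<le> M"
  shows "\<exists>v. compatible v \<and> (\<forall>i j. p ! j = p ! i \<longrightarrow> t j < t i \<longrightarrow> v j < v i) \<and>
    (\<forall>i. even (v i)) \<and> (\<forall>i. 0 < v i)"
proof -
  define v where "v i = 2 * (p ! i * Suc M + t i) + 2" for i
  have ord: "v j < v i" if "i < m" "j < m" "p ! j < p ! i" for i j
  proof -
    have "p ! j * Suc M + t j < Suc (p ! j) * Suc M" using assms(2)[OF that(2)] by simp
    also have "\<dots> \<le> p ! i * Suc M" using that by (intro mult_le_mono1) simp
    finally show ?thesis by (simp add: v_def)
  qed
  have tie: "v j < v i" if "p ! j = p ! i" "t j < t i" for i j
    using that by (simp add: v_def)
  have "inj_on v {..<m}"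
  proof (rule inj_onI, rule ccontr)
    fix i j assume *: "i \<in> {..<m}" "j \<in> {..<m}" "v i = v j" "i \<noteq> j"
    then have "t i \<noteq> t j" using assms(1) by (auto dest: inj_onD)
    with * ord[of i j] ord[of j i] tie[of i j] tie[of j i] show False
      by (metis less_irrefl lessThan_iff linorder_neqE_nat)
  qed
  with ord tie show ?thesis by (intro exI[of _ v]) (auto simp: v_def compatible_def)
qed

lemma compatible_exists':
  "\<exists>v. compatible v \<and> (\<forall>i. even (v i)) \<and> (\<forall>i. 0 < v i)"
  using compatible_exists[of id m] by auto

text \<open>A new maximum is inserted. Whether it plays the last letter of \<open>\<sigma>2\<close>
  or the first of \<open>\<sigma>3\<close>, some letter would have to lie above it.\<close>

lemma Av_neq_if_not_max:
  assumes "i < m" "p ! (d - 1) < p ! i" "j < m" "p ! d < p ! j"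
  shows "Av P \<noteq> Av Q"
proof -
  obtain v where v: "compatible v" using compatible_exists' by blast
  define x where "x = Suc (Max (v ` {..<m}))"
  have lt: "v i < x" if "i < m" for i using that by (auto simp: x_def less_Suc_eq_le)
  have le: "y \<le> x" if "y \<in> insert x (v ` {..<m})" for y using that lt by force
  show ?thesis
  proof (rule single_insertion_separates[of v x, OF v])
    show "x \<notin> v ` {..<m}" using lt by force
  next
    fix w assume "compatible w" "\<And>i. i < m \<Longrightarrow> w i \<in> insert x (v ` {..<m})" "w (d - 1) = x"
    then show False using compatible_less[of w i "d - 1"] le[of "w i"] assms bounds by force
  next
    fix w assume "compatible w" "\<And>i. i < m \<Longrightarrow> w i \<in> insert x (v ` {..<m})" "w d = x"
    then show False using compatible_less[of w j d] le[of "w j"] assms bounds by force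
  qed
qed

text \<open>Dual of \<open>Av_neq_if_not_max\<close>: all values of \<open>v\<close> are positive,
  so \<open>0\<close> is a new minimum.\<close>

lemma Av_neq_if_not_min:
  assumes "i < m" "p ! i < p ! (d - 1)" "j < m" "p ! j < p ! d"
  shows "Av P \<noteq> Av Q"
proof -
  obtain v where v: "compatible v" "\<And>i. 0 < v i" using compatible_exists' by blast
  show ?thesis
  proof (rule single_insertion_separates[of v 0, OF v(1)])
    show "0 \<notin> v ` {..<m}" using v(2) by (metis imageE less_irrefl)
  next
    fix w assume "compatible w" "w (d - 1) = 0"
    then show False using compatible_less[of w "d - 1" i] assms bounds by force
  next
    fix w assume "compatible w" "w d = 0"
    then show False using compatible_less[of w d j] assms bounds by force
  qed
qed

text \<open>The inserted value separates the values of the two middle letters. As the last letter of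
  \<open>\<sigma>2\<close> it has too few values above it, as the first letter of
  \<open>\<sigma>3\<close> too few below it.\<close>

lemma Av_neq_if_two_between:
  assumes "i < m" "p ! (d - 1) < p ! i" "p ! i < p ! d"
    and "j < m" "p ! (d - 1) < p ! j" "p ! j < p ! d" and "i \<noteq> j"
  shows "Av P \<noteq> Av Q"
proof -
  obtain v where v: "compatible v" "\<And>i. even (v i)" using compatible_exists' by blast
  \<comment> \<open>The pair is renamed so that \<open>v i < v j\<close>; the lower bound is kept
    for \<open>i\<close> and the upper bound for \<open>j\<close>.\<close>
  have "\<exists>i j. i < m \<and> p ! (d - 1) < p ! i \<and> j < m \<and> p ! j < p ! d \<and> v i < v j"
    using assms v(1) by (metis compatible_def inj_onD lessThan_iff linorder_neqE_nat)
  then obtain i j where ij: "i < m" "p ! (d - 1) < p ! i" "j < m" "p ! j < p ! d" "v i < v j"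
    by blast
  define x where "x = Suc (v i)"
  have xj: "x < v j"
    using ij(5) v(2)[of i] v(2)[of j] unfolding x_def by (metis Suc_lessI even_Suc)
  show ?thesis
  proof (rule single_insertion_separates[of v x, OF v(1)])
    show "x \<notin> v ` {..<m}" using v(2) by (auto simp: x_def) (metis even_Suc)
  next
    fix w assume w: "compatible w" "\<And>i. i < m \<Longrightarrow> w i \<in> insert x (v ` {..<m})" "w (d - 1) = x"
    \<comment> \<open>\<open>w\<close> would inject these letters into the old values of the same
      letters without \<open>i\<close>, since \<open>v i\<close> lies below
      \<open>x\<close>.\<close>
    let ?U = "{l. l < m \<and> p ! (d - 1) < p ! l}"
    have "card ?U \<le> card (v ` (?U - {i}))"
    proof (rule card_inj_on_le[where f = w])
      show "inj_on w ?U" using w(1) by (auto simp: compatible_def intro: inj_on_subset)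
      show "w ` ?U \<subseteq> v ` (?U - {i})"
      proof safe
        fix l assume l: "l < m" "p ! (d - 1) < p ! l"
        then have "x < w l" using compatible_less[OF w(1), of l "d - 1"] w(3) bounds by simp
        with w(2)[OF l(1)] obtain l' where l': "l' < m" "w l = v l'" "v i < v l'"
          by (auto simp: x_def)
        then have "p ! (d - 1) < p ! l'"
          using compatible_less[OF v(1), of i l'] ij by force
        with l' show "w l \<in> v ` (?U - {i})" by auto
      qed
    qed simp
    also have "\<dots> \<le> card (?U - {i})" by (rule card_image_le) simp
    also have "\<dots> < card ?U" using ij by (intro psubset_card_mono) auto
    finally show False by simp
  next
    fix w assume w: "compatible w" "\<And>i. i < m \<Longrightarrow> w i \<in> insert x (v ` {..<m})" "w d = x"
    let ?U = "{l. l < m \<and> p ! l < p ! d}"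
    have "card ?U \<le> card (v ` (?U - {j}))"
    proof (rule card_inj_on_le[where f = w])
      show "inj_on w ?U" using w(1) by (auto simp: compatible_def intro: inj_on_subset)
      show "w ` ?U \<subseteq> v ` (?U - {j})"
      proof safe
        fix l assume l: "l < m" "p ! l < p ! d"
        then have "w l < x" using compatible_less[OF w(1), of d l] w(3) bounds by simp
        with w(2)[OF l(1)] obtain l' where l': "l' < m" "w l = v l'" "v l' < v j"
          using xj by auto
        then have "p ! l' < p ! d"
          using compatible_less[OF v(1), of l' j] ij by force
        with l' show "w l \<in> v ` (?U - {j})" by auto
      qed
    qed simp
    also have "\<dots> \<le> card (?U - {j})" by (rule card_image_le) simp
    also have "\<dots> < card ?U" using ij by (intro psubset_card_mono) auto
    finally show False by simp
  qed
qed

text \<open>Insert a new maximum followed by a new minimum.\<close>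

lemma Av_neq_if_both_long:
  assumes "Suc e < d" "Suc d < f"
    and "i < m" "p ! (d - 1) < p ! i" "i' < m" "p ! (d - 2) < p ! i'" "j < m" "p ! j < p ! Suc d"
  shows "Av P \<noteq> Av Q"
proof -
  obtain v where v: "compatible v" "\<And>i. 0 < v i" using compatible_exists' by blast
  define x where "x = Suc (Max (v ` {..<m}))"
  have lt: "v i < x" if "i < m" for i using that by (auto simp: x_def less_Suc_eq_le)
  have le: "y \<le> x" if "y \<in> v ` {..<m} \<union> set [x, 0]" for y using that lt by force
  show ?thesis
  proof (rule insertion_separates[of v "[x, 0]", OF v(1)])
    show "distinct [x, 0]" by (simp add: x_def)
    have "0 \<notin> v ` {..<m}" using v(2) by (metis imageE less_irrefl)
    moreover have "x \<notin> v ` {..<m}" using lt by force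
    ultimately show "set [x, 0] \<inter> v ` {..<m} = {}" by simp
  next
    fix w \<delta>
    assume w: "compatible w" "w ` {..<m} \<subseteq> v ` {..<m} \<union> set [x, 0]"
      and \<delta>: "\<delta> \<le> length [x, 0]"
      and pos: "\<And>i. e \<le> i \<Longrightarrow> i < f \<Longrightarrow> w i = (map v [0..<d] @ [x, 0] @ map v [d..<m]) ! (i + \<delta>)"
    have le: "w i \<le> x" if "i < m" for i using le w(2) that by blast
    \<comment> \<open>The new minimum plays the second letter of \<open>\<sigma>3\<close> for shift
      0; the new maximum plays the last letter of \<open>\<sigma>2\<close> for shift 1 and the one
      before it for shift 2.\<close>
    consider "\<delta> = 0" | "\<delta> = 1" | "\<delta> = 2" using \<delta> by fastforce
    then show False
    proof cases
      case 1
      then have "w (Suc d) = 0" using pos[of "Suc d"] assms bounds by (auto simp: nth_append)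
      then show False using compatible_less[OF w(1), of "Suc d" j] assms bounds by simp
    next
      case 2
      then have "w (d - 1) = x" using pos[of "d - 1"] assms bounds by (auto simp: nth_append)
      then show False using compatible_less[OF w(1), of i "d - 1"] le[of i] assms bounds by simp
    next
      case 3
      then have "w (d - 2) = x" using pos[of "d - 2"] assms bounds by (auto simp: nth_append)
      moreover have "d - 2 < m" using bounds by linarith
      ultimately show False
        using compatible_less[OF w(1), of i' "d - 2"] le[of i'] assms by simp
    qed
  qed
qed

text \<open>Insert a new maximum and let \<open>g\<close> carry the second largest value: the letter after \<open>g\<close>
  would receive that value, although at least two letters must lie above it.\<close>

lemma Av_neq_if_drop_from_max:
  assumes g: "d \<le> g" "Suc g < f" "\<And>l. l < m \<Longrightarrow> p ! l \<le> p ! g"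
    and l: "l < m" "p ! (d - 1) < p ! l"
    and ij: "i < m" "j < m" "i \<noteq> j" "p ! Suc g < p ! i" "p ! Suc g < p ! j"
  shows "Av P \<noteq> Av Q"
proof -
  \<comment> \<open>This tie-break puts \<open>g\<close> above all letters equal to it, so
    \<open>v g\<close> is the largest old value.\<close>
  let ?t = "\<lambda>i. if i = g then m else i"
  have gm: "g < m" using g bounds by simp
  then have t: "inj_on ?t {..<m}" "\<And>i. i < m \<Longrightarrow> ?t i \<le> m"
    by (auto simp: inj_on_def split: if_splits)
  obtain v where v: "compatible v" "\<And>i j. p ! j = p ! i \<Longrightarrow> ?t j < ?t i \<Longrightarrow> v j < v i"
    using compatible_exists[OF t] by blast
  have vg: "v l \<le> v g" if "l < m" for l
    using v(2)[of l g] compatible_less[OF v(1), of g l] g(3)[OF that] that gm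
    by (cases "p ! l = p ! g"; cases "l = g") auto
  define x where "x = Suc (v g)"
  have lt: "v i < x" if "i < m" for i using vg[OF that] by (simp add: x_def)
  show ?thesis
  proof (rule single_insertion_separates[of v x, OF v(1)])
    show "x \<notin> v ` {..<m}" using lt by force
  next
    fix w assume "compatible w" "\<And>i. i < m \<Longrightarrow> w i \<in> insert x (v ` {..<m})" "w (d - 1) = x"
    then show False using compatible_less[of w l "d - 1"] lt l bounds by force
  next
    fix w assume w: "compatible w" "\<And>i. i < m \<Longrightarrow> w i \<in> insert x (v ` {..<m})"
      and "\<And>i. d \<le> i \<Longrightarrow> Suc i < f \<Longrightarrow> w (Suc i) = v i"
    then have wg: "w (Suc g) = v g" using g by simp
    have "w l = x" if "l < m" "p ! Suc g < p ! l" for l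
    proof -
      have "v g < w l" using compatible_less[OF w(1), of l "Suc g"] wg that g bounds by simp
      with w(2)[OF that(1)] vg show ?thesis by (auto simp: not_less[symmetric])
    qed
    then have "w i = x" "w j = x" using ij by auto
    with compatible_eqD[OF w(1), of i j] ij show False by simp
  qed
qed

text \<open>Dual of \<open>Av_neq_if_drop_from_max\<close>: the minimum \<open>0\<close> is inserted
  and \<open>Suc g\<close> carries the smallest old value. Under the shifted reading
  \<open>g\<close> receives that value, so both \<open>i\<close> and \<open>j\<close> would have to
  receive \<open>0\<close>.\<close>

lemma Av_neq_if_drop_to_min:
  assumes g: "e \<le> g" "Suc g < d" "\<And>l. l < m \<Longrightarrow> p ! Suc g \<le> p ! l"
    and l: "l < m" "p ! l < p ! d"
    and ij: "i < m" "j < m" "i \<noteq> j" "p ! i < p ! g" "p ! j < p ! g"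
  shows "Av P \<noteq> Av Q"
proof -
  let ?t = "\<lambda>i. if i = Suc g then 0 else Suc i"
  have gm: "Suc g < m" using g bounds by simp
  have t: "inj_on ?t {..<m}" "\<And>i. i < m \<Longrightarrow> ?t i \<le> m"
    by (auto simp: inj_on_def split: if_splits)
  obtain v where v: "compatible v" "\<And>i j. p ! j = p ! i \<Longrightarrow> ?t j < ?t i \<Longrightarrow> v j < v i"
      "\<And>i. 0 < v i"
    using compatible_exists[OF t] by blast
  have vg: "v (Suc g) \<le> v l" if "l < m" for l
    using v(2)[of "Suc g" l] compatible_less[OF v(1), of l "Suc g"] g(3)[OF that] that gm
    by (cases "p ! l = p ! Suc g"; cases "l = Suc g") auto
  show ?thesis
  proof (rule single_insertion_separates[of v 0, OF v(1)])
    show "0 \<notin> v ` {..<m}" using v(3) by (metis imageE less_irrefl)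
  next
    fix w assume w: "compatible w" "\<And>i. i < m \<Longrightarrow> w i \<in> insert 0 (v ` {..<m})"
      and "\<And>i. e \<le> i \<Longrightarrow> Suc i < d \<Longrightarrow> w i = v (Suc i)"
    then have wg: "w g = v (Suc g)" using g by simp
    have "w l = 0" if "l < m" "p ! l < p ! g" for l
    proof -
      have "w l < v (Suc g)" using compatible_less[OF w(1), of g l] wg that gm by simp
      with w(2)[OF that(1)] vg show ?thesis by (auto simp: not_less[symmetric])
    qed
    then have "w i = 0" "w j = 0" using ij by auto
    with compatible_eqD[OF w(1), of i j] ij show False by simp
  next
    fix w assume "compatible w" "w d = 0"
    then show False using compatible_less[of w d l] l bounds by force
  qed
qed

text \<open>The inserted value lies just below \<open>v d\<close>, the only value above it. As the
  last letter of \<open>\<sigma>2\<close> it would force two letters onto \<open>v d\<close>; as the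
  first letter of \<open>\<sigma>3\<close> it would be followed by \<open>v d\<close>, which is too
  large for the next letter.\<close>

lemma Av_neq_if_unique_max:
  assumes d: "Suc d < f" "\<And>l. l < m \<Longrightarrow> l \<noteq> d \<Longrightarrow> p ! l < p ! d"
    and ij: "i < m" "j < m" "i \<noteq> j" "p ! (d - 1) < p ! i" "p ! (d - 1) < p ! j"
  shows "Av P \<noteq> Av Q"
proof -
  obtain v where v: "compatible v" "\<And>i. even (v i)" "\<And>i. 0 < v i" using compatible_exists' by blast
  define x where "x = v d - 1"
  have x: "Suc x = v d" using v(3)[of d] by (simp add: x_def)
  have S: "y = v d" if "y \<in> insert x (v ` {..<m})" "x < y" for y
    using that compatible_less[OF v(1), of d] d bounds x by fastforce
  show ?thesis
  proof (rule single_insertion_separates[of v x, OF v(1)])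
    show "x \<notin> v ` {..<m}" using v(2) x by (metis even_Suc imageE)
  next
    fix w assume w: "compatible w" "\<And>i. i < m \<Longrightarrow> w i \<in> insert x (v ` {..<m})" "w (d - 1) = x"
    have "w l = v d" if "l < m" "p ! (d - 1) < p ! l" for l
      using compatible_less[OF w(1), of l "d - 1"] w(3) that bounds by (intro S w(2)) auto
    then have "w i = v d" "w j = v d" using ij by auto
    with compatible_eqD[OF w(1), of i j] ij show False by simp
  next
    fix w assume "compatible w" "w d = x" and "\<And>i. d \<le> i \<Longrightarrow> Suc i < f \<Longrightarrow> w (Suc i) = v i"
    then show False using compatible_less[of w d "Suc d"] d(1) d(2)[of "Suc d"] bounds x by auto
  qed
qed

text \<open>Dual of \<open>Av_neq_if_unique_max\<close>, with the inserted value just above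
  \<open>v (d - 1)\<close>.\<close>

lemma Av_neq_if_unique_min:
  assumes d: "Suc e < d" "\<And>l. l < m \<Longrightarrow> l \<noteq> d - 1 \<Longrightarrow> p ! (d - 1) < p ! l"
    and ij: "i < m" "j < m" "i \<noteq> j" "p ! i < p ! d" "p ! j < p ! d"
  shows "Av P \<noteq> Av Q"
proof -
  obtain v where v: "compatible v" "\<And>i. even (v i)" using compatible_exists' by blast
  define x where "x = Suc (v (d - 1))"
  have S: "y = v (d - 1)" if "y \<in> insert x (v ` {..<m})" "y < x" for y
    using that compatible_less[OF v(1), of _ "d - 1"] d bounds x_def by fastforce
  show ?thesis
  proof (rule single_insertion_separates[of v x, OF v(1)])
    show "x \<notin> v ` {..<m}" using v(2) x_def by (metis even_Suc imageE)
  next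
    fix w assume "compatible w" "w (d - 1) = x" and w: "\<And>i. e \<le> i \<Longrightarrow> Suc i < d \<Longrightarrow> w i = v (Suc i)"
    moreover define g where "g = d - 2"
    have g: "d - 1 = Suc g" "e \<le> g" "Suc g < d" "Suc g < m"
      using d(1) bounds by (auto simp: g_def)
    moreover have "w g = v (Suc g)" using w g by simp
    ultimately show False
      using compatible_less[of w g "Suc g"] d(2)[of g] x_def by auto
  next
    fix w assume w: "compatible w" "\<And>i. i < m \<Longrightarrow> w i \<in> insert x (v ` {..<m})" "w d = x"
    have "w l = v (d - 1)" if "l < m" "p ! l < p ! d" for l
      using compatible_less[OF w(1), of d l] w(3) that bounds by (intro S w(2)) auto
    then have "w i = v (d - 1)" "w j = v (d - 1)" using ij by auto
    with compatible_eqD[OF w(1), of i j] ij show False by simp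
  qed
qed

section \<open>Translation between indices and the shape of the segments\<close>

lemma all_\<sigma>2: "(\<forall>i. e \<le> i \<longrightarrow> i < d \<longrightarrow> p ! i = c) \<longleftrightarrow> \<sigma>2 = replicate (length \<sigma>2) c"
proof -
  have "(\<forall>i. e \<le> i \<longrightarrow> i < d \<longrightarrow> p ! i = c) \<longleftrightarrow> (\<forall>i<length \<sigma>2. p ! (e + i) = c)"
    unfolding d_def by (metis le_add1 le_add_diff_inverse nat_add_left_cancel_less)
  then show ?thesis by (simp add: nth_\<sigma>2 list_eq_iff_nth_eq)
qed

lemma all_\<sigma>3: "(\<forall>i. d \<le> i \<longrightarrow> i < f \<longrightarrow> p ! i = c) \<longleftrightarrow> \<sigma>3 = replicate (length \<sigma>3) c"
proof -
  have "(\<forall>i. d \<le> i \<longrightarrow> i < f \<longrightarrow> p ! i = c) \<longleftrightarrow> (\<forall>i<length \<sigma>3. p ! (d + i) = c)"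
    unfolding f_def by (metis le_add1 le_add_diff_inverse nat_add_left_cancel_less)
  then show ?thesis by (simp add: nth_\<sigma>3 list_eq_iff_nth_eq)
qed

lemma count_1_iff: "count_list p c = 1 \<longleftrightarrow> (\<exists>!i. i < m \<and> p ! i = c)"
proof -
  have "count_list p c = card {i. i < m \<and> p ! i = c}"
    by (simp add: count_list_eq_length_filter length_filter_conv_card m_def eq_commute)
  also have "\<dots> = 1 \<longleftrightarrow> (\<exists>!i. i < m \<and> p ! i = c)"
    unfolding One_nat_def card_1_singleton_iff set_eq_iff mem_Collect_eq singleton_iff by metis
  finally show ?thesis .
qed

lemma hd_\<sigma>3: "p ! d = hd \<sigma>3"
  using nth_\<sigma>3[of 0] \<sigma>3_ne by (simp add: hd_conv_nth)

lemma last_\<sigma>2: "p ! (d - 1) = last \<sigma>2"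
  using nth_\<sigma>2[of "length \<sigma>2 - 1"] \<sigma>2_ne by (simp add: last_conv_nth d_def Suc_le_eq)

section \<open>Sufficiency of the properties\<close>

text \<open>The threshold is the largest value playing a letter \<open>1\<close>. There are no
  intermediate letters to protect.\<close>

lemma Av_eq_if_two_letters:
  assumes p: "set p = {1..2}"
    and \<sigma>: "\<sigma>2 = replicate (length \<sigma>2) 1" "\<sigma>3 = replicate (length \<sigma>3) 2"
    and len: "length \<sigma>2 = 1 \<or> length \<sigma>3 = 1"
  shows "Av P = Av Q"
  unfolding Av_eq_iff
proof (intro ballI allI impI)
  fix \<pi> k assume occ: "occ_at P \<pi> k"
  have range: "1 \<le> p ! i \<and> p ! i \<le> 2" if "i < m" for i
    using nth_mem[of i p] that p by (auto simp: m_def)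
  have \<sigma>2: "p ! i = 1" if "e \<le> i" "i < d" for i using \<sigma>(1) that unfolding all_\<sigma>2[symmetric] by blast
  have \<sigma>3: "p ! i = 2" if "d \<le> i" "i < f" for i using \<sigma>(2) that unfolding all_\<sigma>3[symmetric] by blast
  define W where "W = (\<lambda>i. \<pi> ! k i) ` {i. i < m \<and> p ! i = 1}"
  have W: "finite W" "W \<noteq> {}" using \<sigma>2[of e] bounds by (auto simp: W_def intro: exI[of _ e])
  show "\<exists>k. occ_at Q \<pi> k"
  proof (rule threshold_occ_Q[OF occ \<sigma>2 \<sigma>3 range _ len, where w = "Max W"])
    show "\<pi> ! k i \<le> Max W" if "i < m" "p ! i < 2" for i
      using that W range[of i] by (intro Max_ge) (auto simp: W_def)
    show "Max W < \<pi> ! k i" if "i < m" "p ! i = 2" for i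
      using that W k_order[OF occ] by (subst Max_less_iff) (auto simp: W_def)
  qed auto
qed

text \<open>The threshold is the value playing the only letter \<open>2\<close>, which lies outside the two blocks.\<close>

lemma Av_eq_if_three_letters:
  assumes p: "set p = {1..3}" and two: "\<exists>!i. i < m \<and> p ! i = 2"
    and \<sigma>: "\<sigma>2 = replicate (length \<sigma>2) 1" "\<sigma>3 = replicate (length \<sigma>3) 3"
    and len: "length \<sigma>2 = 1 \<or> length \<sigma>3 = 1"
  shows "Av P = Av Q"
  unfolding Av_eq_iff
proof (intro ballI allI impI)
  fix \<pi> k assume "\<pi> \<in> perms" and occ: "occ_at P \<pi> k"
  then have dist: "distinct \<pi>" by (simp add: perms_distinct)
  have range: "1 \<le> p ! i \<and> p ! i \<le> 3" if "i < m" for i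
    using nth_mem[of i p] that p by (auto simp: m_def)
  have \<sigma>2: "p ! i = 1" if "e \<le> i" "i < d" for i using \<sigma>(1) that unfolding all_\<sigma>2[symmetric] by blast
  have \<sigma>3: "p ! i = 3" if "d \<le> i" "i < f" for i using \<sigma>(2) that unfolding all_\<sigma>3[symmetric] by blast
  from two obtain t where t: "t < m" "p ! t = 2" and uniq: "\<And>i. i < m \<Longrightarrow> p ! i = 2 \<Longrightarrow> i = t"
    by blast
  show "\<exists>k. occ_at Q \<pi> k"
  proof (rule threshold_occ_Q[OF occ \<sigma>2 \<sigma>3 range _ len, where w = "\<pi> ! k t"])
    show "\<pi> ! k i \<le> \<pi> ! k t" if "i < m" "p ! i < 3" for i
    proof (cases "i = t")
      case False
      then have "p ! i < p ! t" using that t uniq[of i] range[of i] by force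
      then show ?thesis using k_order[OF occ t(1) that(1)] by simp
    qed simp
    show "\<pi> ! k t < \<pi> ! k i" if "i < m" "p ! i = 3" for i
      using k_order[OF occ that(1) t(1)] that t by simp
    show "\<pi> ! x < \<pi> ! k i"
      if "i < m" "1 < p ! i" "p ! i < 3" "i < e \<or> f \<le> i" "k e \<le> x" "x \<le> k (f - 1)" "\<pi> ! x \<le> \<pi> ! k t"
      for i x
    proof -
      have "i = t" using uniq[of i] that by simp
      \<comment> \<open>Position \<open>k t\<close> is outside the span containing \<open>x\<close>,
        so distinctness makes the comparison with the threshold strict.\<close>
      have "t < e \<or> f - 1 < t" using that(4) \<open>i = t\<close> bounds by linarith
      then have "x \<noteq> k t"
        using that(5,6) k_less[OF occ, of t e] k_less[OF occ, of "f - 1" t] t bounds by auto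
      moreover have "x < length \<pi>" "k t < length \<pi>"
        using that(6) k_bound[OF occ, of "f - 1"] k_bound[OF occ t(1)] bounds by auto
      ultimately have "\<pi> ! x \<noteq> \<pi> ! k t" using dist by (simp add: nth_eq_iff_index_eq)
      with that(7) \<open>i = t\<close> show ?thesis by simp
    qed
  qed auto
qed

lemma Av_eq_if_unique_one:
  assumes "\<And>i. i < m \<Longrightarrow> p ! i = (if i = d - 1 then 1 else 2)"
  shows "Av P = Av Q"
  unfolding Av_eq_iff using unique_one_occ_Q[OF _ _ assms] perms_distinct by blast

lemma Av_eq_if_unique_two:
  assumes "\<And>i. i < m \<Longrightarrow> p ! i = (if i = d then 2 else 1)"
  shows "Av P = Av Q"
  unfolding Av_eq_iff using unique_two_occ_Q[OF _ _ assms] perms_distinct by blast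

section \<open>Necessary conditions\<close>

text \<open>Somewhere in \<open>\<sigma>3\<close> the maximal letter is followed by a smaller one.
  Letters \<open>d\<close> and \<open>i\<close> are two letters above the smaller one, as
  \<open>Av_neq_if_drop_from_max\<close> demands.\<close>

lemma Av_neq_if_not_constant_\<sigma>3:
  assumes max: "\<And>l. l < m \<Longrightarrow> p ! l \<le> p ! d" and "p ! (d - 1) < p ! d"
    and i: "i < m" "i \<noteq> d" "p ! i = p ! d"
    and l: "d \<le> l" "l < f" "p ! l \<noteq> p ! d"
  shows "Av P \<noteq> Av Q"
proof -
  have "\<exists>g\<ge>d. g < l \<and> p ! g = p ! d \<and> p ! Suc g \<noteq> p ! d"
    using l(1,3)
  proof (induction l rule: dec_induct)
    case (step n) then show ?case by (cases "p ! n = p ! d") auto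
  qed simp
  then obtain g where g: "d \<le> g" "g < l" "p ! g = p ! d" "p ! Suc g \<noteq> p ! d" by blast
  have "p ! Suc g < p ! d" using max[of "Suc g"] g l bounds by simp
  then show ?thesis
    using assms g bounds
    by (intro Av_neq_if_drop_from_max[of g d i d]) auto
qed

text \<open>Dual: somewhere in \<open>\<sigma>2\<close> a larger letter is followed by the minimal
  one, and \<open>d - 1\<close> and \<open>i\<close> are two letters below the larger one.\<close>

lemma Av_neq_if_not_constant_\<sigma>2:
  assumes min: "\<And>l. l < m \<Longrightarrow> p ! (d - 1) \<le> p ! l" and "p ! (d - 1) < p ! d"
    and i: "i < m" "i \<noteq> d - 1" "p ! i = p ! (d - 1)"
    and l: "e \<le> l" "l < d" "p ! l \<noteq> p ! (d - 1)"
  shows "Av P \<noteq> Av Q"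
proof -
  have "l \<le> d - 1" using l by simp
  then have "\<exists>g\<ge>l. Suc g < d \<and> p ! g \<noteq> p ! (d - 1) \<and> p ! Suc g = p ! (d - 1)"
    using l(3)
  proof (induction l rule: inc_induct)
    case (step n)
    show ?case
    proof (cases "p ! Suc n = p ! (d - 1)")
      case True with step show ?thesis by (intro exI[of _ n]) auto
    next
      case False with step.IH show ?thesis by (meson Suc_leD)
    qed
  qed simp
  then obtain g where g: "l \<le> g" "Suc g < d" "p ! g \<noteq> p ! (d - 1)" "p ! Suc g = p ! (d - 1)"
    by blast
  have "p ! (d - 1) < p ! g" using min[of g] g bounds by simp
  then show ?thesis
    using assms g bounds
    by (intro Av_neq_if_drop_to_min[of g "d - 1" i "d - 1"]) auto
qed

text \<open>Collects the contrapositives of the separation lemmas. The maximum and the minimum must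
  occur among the two meeting letters, and \<open>le\<close> decides which is which.\<close>

lemma Av_eq_imp:
  assumes eq: "Av P = Av Q" and p: "set p = {1..r}" and r: "2 \<le> r" and le: "p ! (d - 1) \<le> p ! d"
  shows "p ! (d - 1) = 1" "p ! d = r"
    and "i < m \<Longrightarrow> j < m \<Longrightarrow> 1 < p ! i \<Longrightarrow> p ! i < r \<Longrightarrow> 1 < p ! j \<Longrightarrow> p ! j < r \<Longrightarrow> i = j"
    and "\<sigma>2 = replicate (length \<sigma>2) 1 \<or> r = 2 \<and> (\<forall>i<m. i \<noteq> d - 1 \<longrightarrow> p ! i = 2)"
    and "\<sigma>3 = replicate (length \<sigma>3) r \<or> r = 2 \<and> (\<forall>i<m. i \<noteq> d \<longrightarrow> p ! i = 1)"
    and "\<sigma>2 = replicate (length \<sigma>2) 1 \<Longrightarrow> \<sigma>3 = replicate (length \<sigma>3) r \<Longrightarrow>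
      length \<sigma>2 = 1 \<or> length \<sigma>3 = 1"
proof -
  have range: "1 \<le> p ! i \<and> p ! i \<le> r" if "i < m" for i
    using nth_mem[of i p] that p by (auto simp: m_def)
  have ex: "\<exists>i<m. p ! i = c" if "1 \<le> c" "c \<le> r" for c
  proof -
    have "c \<in> set p" using that p by auto
    then show ?thesis by (auto simp: in_set_conv_nth m_def)
  qed
  obtain i1 where i1: "i1 < m" "p ! i1 = 1" using ex[of 1] r by auto
  obtain ir where ir: "ir < m" "p ! ir = r" using ex[of r] r by auto
  have dm: "d - 1 < m" "d < m" using bounds by auto
  have "p ! (d - 1) = r \<or> p ! d = r"
    using Av_neq_if_not_max[of ir ir] ir range[OF dm(1)] range[OF dm(2)] eq by force
  moreover have "p ! (d - 1) = 1 \<or> p ! d = 1"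
    using Av_neq_if_not_min[of i1 i1] i1 range[OF dm(1)] range[OF dm(2)] eq by force
  ultimately show s: "p ! (d - 1) = 1" and t: "p ! d = r"
    using le r range[OF dm(1)] range[OF dm(2)] by auto
  show "i < m \<Longrightarrow> j < m \<Longrightarrow> 1 < p ! i \<Longrightarrow> p ! i < r \<Longrightarrow> 1 < p ! j \<Longrightarrow> p ! j < r \<Longrightarrow> i = j"
    for i j
    using Av_neq_if_two_between[of i j] s t eq by metis
  show "\<sigma>2 = replicate (length \<sigma>2) 1 \<or> r = 2 \<and> (\<forall>i<m. i \<noteq> d - 1 \<longrightarrow> p ! i = 2)"
  proof (rule disjCI, unfold all_\<sigma>2[symmetric])
    assume neg: "\<not> (r = 2 \<and> (\<forall>i<m. i \<noteq> d - 1 \<longrightarrow> p ! i = 2))"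
    show "\<forall>i. e \<le> i \<longrightarrow> i < d \<longrightarrow> p ! i = 1"
    \<comment> \<open>A second \<open>1\<close> forces \<open>\<sigma>2\<close> to be constant.
      Otherwise index \<open>d - 1\<close> is the unique minimum and \<open>3 \<le> r\<close>, so a
      letter \<open>2\<close> and the letter \<open>1\<close> are two letters below
      \<open>p ! d\<close>, and \<open>\<sigma>2\<close> has only one letter.\<close>
    proof (cases "\<exists>i<m. i \<noteq> d - 1 \<and> p ! i = 1")
      case True
      then show ?thesis using Av_neq_if_not_constant_\<sigma>2 eq s t r range by (metis One_nat_def Suc_1 Suc_le_lessD)
    next
      case False
      then have uniq: "p ! (d - 1) < p ! l" if "l < m" "l \<noteq> d - 1" for l
        using range[of l] that s by force
      have "r \<noteq> 2" using neg uniq range s by force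
      then obtain i2 where i2: "i2 < m" "p ! i2 = 2" using ex[of 2] r by auto
      have "\<not> Suc e < d"
        using Av_neq_if_unique_min[OF _ uniq, of i2 "d - 1"] i2 s t r dm \<open>r \<noteq> 2\<close> eq by force
      then show ?thesis using s by (metis One_nat_def Suc_lessI diff_Suc_1 le_less_trans not_less_eq not_le)
    qed
  qed
  show "\<sigma>3 = replicate (length \<sigma>3) r \<or> r = 2 \<and> (\<forall>i<m. i \<noteq> d \<longrightarrow> p ! i = 1)"
  proof (rule disjCI, unfold all_\<sigma>3[symmetric])
    assume neg: "\<not> (r = 2 \<and> (\<forall>i<m. i \<noteq> d \<longrightarrow> p ! i = 1))"
    show "\<forall>i. d \<le> i \<longrightarrow> i < f \<longrightarrow> p ! i = r"
    proof (cases "\<exists>i<m. i \<noteq> d \<and> p ! i = r")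
      case True
      then show ?thesis using Av_neq_if_not_constant_\<sigma>3 eq s t r range by (metis One_nat_def Suc_1 Suc_le_lessD)
    next
      case False
      then have uniq: "p ! l < p ! d" if "l < m" "l \<noteq> d" for l
        using range[of l] that t by force
      have "r \<noteq> 2" using neg uniq range t by force
      then obtain i2 where i2: "i2 < m" "p ! i2 = 2" using ex[of 2] r by auto
      have "\<not> Suc d < f"
        using Av_neq_if_unique_max[OF _ uniq, of i2 d] i2 s t r dm \<open>r \<noteq> 2\<close> eq by force
      then show ?thesis using t by (metis le_antisym less_Suc_eq_le not_less_eq order_less_le_trans not_le)
    qed
  qed
  assume \<sigma>: "\<sigma>2 = replicate (length \<sigma>2) 1" "\<sigma>3 = replicate (length \<sigma>3) r"
  show "length \<sigma>2 = 1 \<or> length \<sigma>3 = 1"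
  proof (rule ccontr)
    assume "\<not> ?thesis"
    then have len: "Suc e < d" "Suc d < f"
      using bounds(1,2) unfolding d_def f_def by linarith+
    have "p ! (d - 2) = 1" "p ! Suc d = r"
      using \<sigma> len unfolding all_\<sigma>2[symmetric] all_\<sigma>3[symmetric] by auto
    then show False
      using Av_neq_if_both_long[OF len, of d d "d - 1"] dm s t r eq by simp
  qed
qed

section \<open>The characterization\<close>

lemma Av_eq_iff_properties:
  assumes p: "set p = {1..r}" and r: "2 \<le> r" and le: "last \<sigma>2 \<le> hd \<sigma>3"
  shows "Av P = Av Q \<longleftrightarrow>
      ((\<exists>a\<ge>1. \<sigma>2 = replicate a 1) \<and> \<sigma>3 = [2] \<and> p \<in> lists {1,2})
    \<or> (\<sigma>2 = [1] \<and> (\<exists>b\<ge>1. \<sigma>3 = replicate b 2) \<and> p \<in> lists {1,2})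
    \<or> ((\<exists>a\<ge>1. \<sigma>2 = replicate a 2 @ [1]) \<and> (\<exists>b\<ge>1. \<sigma>3 = replicate b 2) \<and>
        p \<in> lists {1,2} \<and> count_list p 1 = 1)
    \<or> ((\<exists>a\<ge>1. \<sigma>2 = replicate a 1) \<and> (\<exists>b\<ge>1. \<sigma>3 = 2 # replicate b 1) \<and>
        p \<in> lists {1,2} \<and> count_list p 2 = 1)
    \<or> ((\<exists>a\<ge>1. \<sigma>2 = replicate a 1) \<and> \<sigma>3 = [3] \<and>
        p \<in> lists {1,2,3} \<and> count_list p 2 = 1)
    \<or> (\<sigma>2 = [1] \<and> (\<exists>b\<ge>1. \<sigma>3 = replicate b 3) \<and>
        p \<in> lists {1,2,3} \<and> count_list p 2 = 1)"
    (is "_ \<longleftrightarrow> ?R")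
proof -
  have range: "1 \<le> p ! i \<and> p ! i \<le> r" if "i < m" for i
    using nth_mem[of i p] that p by (auto simp: m_def)
  have dm: "d - 1 < m" "d < m" using bounds by auto
  have rp: "r \<in> set p" using p r by simp
  have lists2: "p \<in> lists {1,2} \<longleftrightarrow> r = 2"
  proof
    assume "p \<in> lists {1,2}"
    then have "r \<in> {1,2}" using rp unfolding in_lists_conv_set by blast
    then show "r = 2" using r by auto
  qed (use p in \<open>auto simp: in_lists_conv_set\<close>)
  have lists3: "p \<in> lists {1,2,3} \<longleftrightarrow> r \<le> 3"
  proof
    assume "p \<in> lists {1,2,3}"
    then have "r \<in> {1,2,3}" using rp unfolding in_lists_conv_set by blast
    then show "r \<le> 3" by auto
  qed (use p in \<open>auto simp: in_lists_conv_set\<close>)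
  have sub: "set \<sigma>2 \<subseteq> set p" "set \<sigma>3 \<subseteq> set p" by (auto simp: p_def P_def)
  have forward: ?R if eq: "Av P = Av Q"
  proof -
    note * = Av_eq_imp[OF eq p r le[folded hd_\<sigma>3 last_\<sigma>2]]
    have len: "1 \<le> length \<sigma>2" "1 \<le> length \<sigma>3" using \<sigma>2_ne \<sigma>3_ne by (auto simp: Suc_le_eq)
    \<comment> \<open>Otherwise \<open>2\<close> and \<open>3\<close> would occupy two indices with
      letters strictly between \<open>1\<close> and \<open>r\<close>.\<close>
    have "r \<le> 3"
    proof (rule ccontr)
      assume "\<not> r \<le> 3"
      then have "2 \<in> set p" "3 \<in> set p" using p by auto
      then obtain i j where "i < m" "p ! i = 2" "j < m" "p ! j = 3"
        by (auto simp: in_set_conv_nth m_def)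
      with *(3)[of i j] \<open>\<not> r \<le> 3\<close> show False by auto
    qed
    then consider "r = 2" | "r = 3" using r by linarith
    then show ?R
    proof cases
      case 1
      \<comment> \<open>Case \<open>both\<close> leads to properties (1) and (2), \<open>two\<close>
        to (4) and \<open>one\<close> to (3).\<close>
      consider (both) "\<sigma>2 = replicate (length \<sigma>2) 1" "\<sigma>3 = replicate (length \<sigma>3) 2"
        | (two) "\<sigma>3 \<noteq> replicate (length \<sigma>3) 2" "\<forall>i<m. i \<noteq> d \<longrightarrow> p ! i = 1"
        | (one) "\<sigma>2 \<noteq> replicate (length \<sigma>2) 1" "\<forall>i<m. i \<noteq> d - 1 \<longrightarrow> p ! i = 2"
        using *(4,5) 1 by blast
      then show ?thesis
      proof cases
        case both
        from *(6) both 1 have "length \<sigma>2 = 1 \<or> length \<sigma>3 = 1" by simp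
        then have "\<sigma>2 = [1] \<or> \<sigma>3 = [2]" using both by (metis One_nat_def replicate_0 replicate_Suc)
        with both len 1 lists2 show ?thesis by metis
      next
        case two
        have s2: "\<sigma>2 = replicate (length \<sigma>2) 1"
          unfolding all_\<sigma>2[symmetric] using two(2) bounds by auto
        have "i = d" if "i < m" "p ! i = 2" for i using two(2) that by (cases "i = d") auto
        moreover have "d < m \<and> p ! d = 2" using *(2) 1 dm by simp
        ultimately have "count_list p 2 = 1" unfolding count_1_iff by blast
        obtain x ys where xys: "\<sigma>3 = x # ys" using \<sigma>3_ne by (cases \<sigma>3) auto
        have "hd \<sigma>3 = 2" using *(2) 1 by (simp add: hd_\<sigma>3)
        with xys have "x = 2" by simp
        moreover have "ys = replicate (length ys) 1"
        proof (rule nth_equalityI)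
          fix i assume i: "i < length ys"
          then have "Suc i < length \<sigma>3" using xys by simp
          then have "\<sigma>3 ! Suc i = 1"
            using nth_\<sigma>3[of "Suc i"] two(2)[rule_format, of "d + Suc i"] bounds(3)
            by (simp add: f_def)
          with i xys show "ys ! i = replicate (length ys) 1 ! i" by simp
        qed simp
        moreover have "1 \<le> length ys" using two(1) xys \<open>x = 2\<close> by (cases ys) auto
        ultimately have "\<exists>b\<ge>1. \<sigma>3 = 2 # replicate b 1" using xys by blast
        with s2 \<open>count_list p 2 = 1\<close> len 1 lists2 show ?thesis by metis
      next
        case one
        have s3: "\<sigma>3 = replicate (length \<sigma>3) 2"
          unfolding all_\<sigma>3[symmetric] using one(2) bounds by auto
        have "i = d - 1" if "i < m" "p ! i = 1" for i
          using one(2) that by (cases "i = d - 1") auto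
        moreover have "d - 1 < m \<and> p ! (d - 1) = 1" using *(1) dm by simp
        ultimately have "count_list p 1 = 1" unfolding count_1_iff by blast
        obtain x ys where xys: "\<sigma>2 = ys @ [x]" using \<sigma>2_ne by (cases \<sigma>2 rule: rev_cases) auto
        have "last \<sigma>2 = 1" using *(1) unfolding last_\<sigma>2 .
        with xys have "x = 1" by simp
        moreover have "ys = replicate (length ys) 2"
        proof (rule nth_equalityI)
          fix i assume i: "i < length ys"
          then have "Suc i < length \<sigma>2" using xys by simp
          then have "\<sigma>2 ! i = 2"
            using nth_\<sigma>2[of i] one(2)[rule_format, of "e + i"] bounds
            by (simp add: d_def)
          with i xys show "ys ! i = replicate (length ys) 2 ! i" by (simp add: nth_append)
        qed simp
        moreover have "1 \<le> length ys" using one(1) xys \<open>x = 1\<close> by (cases ys) auto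
        ultimately have "\<exists>a\<ge>1. \<sigma>2 = replicate a 2 @ [1]" using xys by blast
        with s3 \<open>count_list p 1 = 1\<close> len 1 lists2 show ?thesis by metis
      qed
    next
      case 2
      then have both: "\<sigma>2 = replicate (length \<sigma>2) 1" "\<sigma>3 = replicate (length \<sigma>3) 3"
        using *(4,5) by auto
      from *(6) both 2 have "length \<sigma>2 = 1 \<or> length \<sigma>3 = 1" by simp
      then have "\<sigma>2 = [1] \<or> \<sigma>3 = [3]" using both by (metis One_nat_def replicate_0 replicate_Suc)
      moreover have "2 \<in> set p" using p 2 by auto
      then have "count_list p 2 = 1"
        unfolding count_1_iff using *(3) 2 by (auto simp: in_set_conv_nth m_def)
      ultimately show ?thesis using both len 2 lists3 by (metis order_refl)
    qed
  qed
  \<comment> \<open>In properties (5) and (6) membership in \<open>lists {1,2,3}\<close> gives only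
    \<open>r \<le> 3\<close>; the letter \<open>3\<close> of \<open>\<sigma>3\<close> fixes
    \<open>r\<close>.\<close>
  have r3: "3 \<in> set \<sigma>3 \<Longrightarrow> r \<le> 3 \<Longrightarrow> r = 3" using sub p by auto
  have two: "Av P = Av Q"
    if "p \<in> lists {1,2}" "\<sigma>2 = replicate (length \<sigma>2) 1" "\<sigma>3 = replicate (length \<sigma>3) 2"
      "length \<sigma>2 = 1 \<or> length \<sigma>3 = 1"
    using that p lists2 by (intro Av_eq_if_two_letters) auto
  have three: "Av P = Av Q"
    if "p \<in> lists {1,2,3}" "\<sigma>2 = replicate (length \<sigma>2) 1" "\<sigma>3 = replicate (length \<sigma>3) 3"
      "length \<sigma>2 = 1 \<or> length \<sigma>3 = 1" "count_list p 2 = 1"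
  proof -
    have "3 \<in> set \<sigma>3" using that(3) \<sigma>3_ne by (metis in_set_replicate length_0_conv)
    then have "r = 3" using r3 lists3 that(1) by simp
    then show ?thesis using that p count_1_iff by (intro Av_eq_if_three_letters) auto
  qed
  have range2: "p ! i = 1 \<or> p ! i = 2" if "p \<in> lists {1,2}" "i < m" for i
    using that nth_mem[of i p] by (auto simp: m_def in_lists_conv_set)
  have one: "Av P = Av Q"
    if "p \<in> lists {1,2}" "count_list p 1 = 1" "\<sigma>2 = replicate a 2 @ [1]" for a
  proof (rule Av_eq_if_unique_one)
    fix i assume "i < m"
    have "last \<sigma>2 = 1" using that(3) by simp
    then have last: "p ! (d - 1) = 1" unfolding last_\<sigma>2 .
    show "p ! i = (if i = d - 1 then 1 else 2)"
    proof (cases "i = d - 1")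
      case False
      then have "p ! i \<noteq> 1"
        using that(2)[unfolded count_1_iff] last dm(1) \<open>i < m\<close> by blast
      with False range2[OF that(1) \<open>i < m\<close>] show ?thesis by simp
    qed (use last in simp)
  qed
  have two': "Av P = Av Q"
    if "p \<in> lists {1,2}" "count_list p 2 = 1" "\<sigma>3 = 2 # replicate b 1" for b
  proof (rule Av_eq_if_unique_two)
    fix i assume "i < m"
    have "hd \<sigma>3 = 2" using that(3) by simp
    then have hd: "p ! d = 2" unfolding hd_\<sigma>3 .
    show "p ! i = (if i = d then 2 else 1)"
    proof (cases "i = d")
      case False
      then have "p ! i \<noteq> 2"
        using that(2)[unfolded count_1_iff] hd dm(2) \<open>i < m\<close> by blast
      with False range2[OF that(1) \<open>i < m\<close>] show ?thesis by simp
    qed (use hd in simp)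
  qed
  have "Av P = Av Q" if ?R
    using that
  proof (elim disjE conjE exE)
    fix a assume "\<sigma>2 = replicate a 1" "\<sigma>3 = [2]" "p \<in> lists {1,2}"
    then show ?thesis by (intro two) simp_all
  next
    fix b assume "\<sigma>2 = [1]" "\<sigma>3 = replicate b 2" "p \<in> lists {1,2}"
    then show ?thesis by (intro two) simp_all
  next
    fix a assume "\<sigma>2 = replicate a 2 @ [1]" "p \<in> lists {1,2}" "count_list p 1 = 1"
    then show ?thesis by (intro one)
  next
    fix b assume "\<sigma>3 = 2 # replicate b 1" "p \<in> lists {1,2}" "count_list p 2 = 1"
    then show ?thesis by (intro two')
  next
    fix a assume "\<sigma>2 = replicate a 1" "\<sigma>3 = [3]" "p \<in> lists {1,2,3}" "count_list p 2 = 1"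
    then show ?thesis by (intro three) simp_all
  next
    fix b assume "\<sigma>2 = [1]" "\<sigma>3 = replicate b 3" "p \<in> lists {1,2,3}" "count_list p 2 = 1"
    then show ?thesis by (intro three) simp_all
  qed
  with forward show ?thesis by (rule iffI)
qed

end

theorem proposition1:
  fixes \<sigma>1 \<sigma>4 :: dashed_word and \<sigma>2 \<sigma>3 :: "nat list" and P Q :: dashed_word
  assumes P: "P = \<sigma>1 @ [\<sigma>2] @ [\<sigma>3] @ \<sigma>4"
    and Q: "Q = \<sigma>1 @ [\<sigma>2 @ \<sigma>3] @ \<sigma>4"
    and "po_pattern P" and "nontrivial P"
    and "po_pattern Q" and "nontrivial Q"
    and "\<sigma>2 \<noteq> []" and "\<sigma>3 \<noteq> []"
    and "last \<sigma>2 \<le> hd \<sigma>3"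
  shows "Av P = Av Q \<longleftrightarrow>
      ((\<exists>a\<ge>1. \<sigma>2 = replicate a 1) \<and> \<sigma>3 = [2] \<and> concat P \<in> lists {1,2})
    \<or> (\<sigma>2 = [1] \<and> (\<exists>b\<ge>1. \<sigma>3 = replicate b 2) \<and> concat P \<in> lists {1,2})
    \<or> ((\<exists>a\<ge>1. \<sigma>2 = replicate a 2 @ [1]) \<and> (\<exists>b\<ge>1. \<sigma>3 = replicate b 2) \<and>
        concat P \<in> lists {1,2} \<and> count_list (concat P) 1 = 1)
    \<or> ((\<exists>a\<ge>1. \<sigma>2 = replicate a 1) \<and> (\<exists>b\<ge>1. \<sigma>3 = 2 # replicate b 1) \<and>
        concat P \<in> lists {1,2} \<and> count_list (concat P) 2 = 1)
    \<or> ((\<exists>a\<ge>1. \<sigma>2 = replicate a 1) \<and> \<sigma>3 = [3] \<and>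
        concat P \<in> lists {1,2,3} \<and> count_list (concat P) 2 = 1)
    \<or> (\<sigma>2 = [1] \<and> (\<exists>b\<ge>1. \<sigma>3 = replicate b 3) \<and>
        concat P \<in> lists {1,2,3} \<and> count_list (concat P) 2 = 1)"
proof -
  interpret F: fused_blocks \<sigma>1 \<sigma>4 \<sigma>2 \<sigma>3
    using assms by unfold_locales
  have PQ: "F.P = P" "F.Q = Q" "F.p = concat P"
    by (simp_all add: P Q F.P_def F.Q_def F.p_def)
  obtain r where r: "set (concat P) = {1..r}" using \<open>po_pattern P\<close> by (auto simp: po_pattern_def)
  then have "2 \<le> r" using \<open>nontrivial P\<close> by (cases "r \<le> 1") (auto simp: nontrivial_def)
  then show ?thesis using F.Av_eq_iff_properties[unfolded PQ, OF r _ \<open>last \<sigma>2 \<le> hd \<sigma>3\<close>] by simp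
qed

end
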